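(* (Fully discrete conservation of mass.) Suppose that the data at the times $t^{\tau}$ and $t^{\tau+1}=t^{\tau}+\Delta t$ are related by the Crank-Nicolson Legendre-Fourier scheme: for $s\in\{e,i\}$, $0\le n\le N_L-1$, $-N_F\le k\le N_F$, $$\frac{C^{s,\tau+1}_{n,k}-C^{s,\tau}_{n,k}}{\Delta t}+\frac{\pi i}{L}k\Big(\sigma_{n+1}\widehat C^s_{n+1,k}+\sigma_n\widehat C^s_{n-1,k}+\overline\sigma\widehat C^s_{n,k}\Big)-\frac{q^s}{4m^s}\Big[\widehat E\star\Big(\sum_{i=0}^{n-1}\sigma_{n,i}\widehat C^s_i-\gamma^s\delta_v[\widehat f^s\phi_n]_{v_a}^{v_b}\Big)\Big]_k=\tfrac12D^s_n\widehat C^s_{n,k},$$ where a hat denotes the sum of the values at $t^{\tau}$ and $t^{\tau+1}$ (e.g. $\widehat E=E^{\tau+1}+E^{\tau}$). Then the mass $M^s(t)=m^s\int_0^L\int_{v_a}^{v_b}f^s(x,v,t)\,dv\,dx$ of each species satisfies $$M^s(t^{\tau+1})-M^s(t^{\tau})=\Delta t\,\mathcal{B}^{s;\tau,\tau+1}_{0,0},\qquad \mathcal{B}^{s;\tau,\tau+1}_{n,0}=-\gamma^s\frac{q^s}{4}(v_b-v_a)L\Big[\widehat E\star\delta_v[\widehat f^s\phi_n]_{v_a}^{v_b}\Big]_0 .$$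
   Context: Let $L>0$, $v_a<v_b$, $\Delta t>0$, integers $N_L\ge4$, $N_F\ge0$; species $s\in\{e,i\}$ have mass $m^s>0$ and charge $q^s\in\mathbb{R}$; $\epsilon_0>0$; $\gamma^s\in\mathbb{R}$ is a penalty coefficient and $\nu_s\ge0$ a collision coefficient. Let $L_n$ be the Legendre polynomials on $[-1,1]$ ($L_0=1$, $L_1(\eta)=\eta$, $(2n+1)\eta L_n=(n+1)L_{n+1}+nL_{n-1}$), $\phi_n(v)=\sqrt{2n+1}\,L_n\big((2v-(v_a+v_b))/(v_b-v_a)\big)$, $\psi_k(x)=e^{2\pi i kx/L}$. Constants: $\overline\sigma=\frac{v_a+v_b}{2}$, $\sigma_0=0$, $\sigma_n=\frac{v_b-v_a}{2}\frac{n}{\sqrt{(2n+1)(2n-1)}}$ for $n\ge1$; $\sigma_{n,i}=\pi_{n,i}\frac{2\sqrt{(2n+1)(2i+1)}}{v_b-v_a}$ with $\pi_{n,i}=0$ if $n-i$ is even, $1$ if odd; $D^s_n=-\nu_s\frac{n(n-1)(n-2)}{(N_L-1)(N_L-2)(N_L-3)}$. At each discrete time $t\in\{t^\tau,t^{\tau+1}\}$ (a superscript $\tau$ denotes the value at $t^{\tau}$): $f^s(x,v,t)=\sum_{n=0}^{N_L-1}C^s_n(x,t)\phi_n(v)$, $C^s_n(x,t)=\sum_{k=-N_F}^{N_F}C^s_{n,k}(t)\psi_k(x)$ (real-valued), with conventions $C^s_{-1}=C^s_{N_L}=0$; the electric field $E(x,t)=\sum_{k=-N_F}^{N_F}E_k(t)\psi_k(x)$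 is real-valued, with $E_0=0$ and (Poisson equation) $\epsilon_0\big(\frac{2\pi i}{L}k\big)E_k=(v_b-v_a)\sum_{s\in\{e,i\}}q^sC^s_{0,k}$ for $k\ne0$. For $g(x,v)$, $\delta_v[g]_{v_a}^{v_b}=\frac{g(x,v_b)-g(x,v_a)}{v_b-v_a}$. For trigonometric polynomials $g,h$ of degree at most $N_F$ with Fourier coefficients $g_j,h_j$ (e.g. $h_j=\frac1L\int_0^Lh\,\psi_{-j}\,dx$), $[g\star h]_k=\sum_{k'=-N_F}^{N_F}g_{k'}h_{k-k'}$, with $h_j=0$ for $|j|>N_F$. *)

theory Defs
  imports "HOL-Analysis.Analysis"
begin

datatype species = Electron | Ion

(* Third equation: the three-term recurrence (2n+1) x L_n = (n+1) L_{n+1} + n L_{n-1}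
   at index n+1, solved for the leading polynomial. *)
fun legendre_poly :: "nat \<Rightarrow> real \<Rightarrow> real" where
  "legendre_poly 0 x = 1"
| "legendre_poly (Suc 0) x = x"
| "legendre_poly (Suc (Suc n)) x =
     ((2 * real n + 3) * x * legendre_poly (Suc n) x - (real n + 1) * legendre_poly n x)
       / (real n + 2)"

definition phi :: "real \<Rightarrow> real \<Rightarrow> nat \<Rightarrow> real \<Rightarrow> real" where
  "phi va vb n v =
     sqrt (2 * real n + 1) * legendre_poly n ((2 * v - (va + vb)) / (vb - va))"

definition psi :: "real \<Rightarrow> int \<Rightarrow> real \<Rightarrow> complex" where
  "psi L k x = exp (2 * of_real pi * \<i> * of_int k * of_real x / of_real L)"

definition sigma_bar :: "real \<Rightarrow> real \<Rightarrow> real" where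
  "sigma_bar va vb = (va + vb) / 2"

definition sigma_coeff :: "real \<Rightarrow> real \<Rightarrow> nat \<Rightarrow> real" where
  "sigma_coeff va vb n =
     (if n = 0 then 0
      else (vb - va) / 2 * (real n / sqrt ((2 * real n + 1) * (2 * real n - 1))))"

definition pi_coeff :: "nat \<Rightarrow> nat \<Rightarrow> real" where
  "pi_coeff n i = (if even (int n - int i) then 0 else 1)"

(* The doubly indexed sigma_{n,i}, not to be confused with sigma_n. *)
definition sigma2 :: "real \<Rightarrow> real \<Rightarrow> nat \<Rightarrow> nat \<Rightarrow> real" where
  "sigma2 va vb n i =
     pi_coeff n i * (2 * sqrt ((2 * real n + 1) * (2 * real i + 1)) / (vb - va))"

definition coll_coeff :: "nat \<Rightarrow> real \<Rightarrow> nat \<Rightarrow> real" where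
  "coll_coeff NL \<nu> n =
     - \<nu> * (real n * (real n - 1) * (real n - 2)
            / ((real NL - 1) * (real NL - 2) * (real NL - 3)))"

definition trig_poly :: "real \<Rightarrow> nat \<Rightarrow> (int \<Rightarrow> complex) \<Rightarrow> real \<Rightarrow> complex" where
  "trig_poly L NF a x = (\<Sum>k = - int NF..int NF. a k * psi L k x)"

definition fourier_coeff :: "real \<Rightarrow> (real \<Rightarrow> complex) \<Rightarrow> int \<Rightarrow> complex" where
  "fourier_coeff L g j = (1 / of_real L) * integral {0..L} (\<lambda>x. g x * psi L (- j) x)"

(* [g * h]_k; Fourier coefficients of h at indices beyond NF count as 0. *)
definition fconv ::
  "real \<Rightarrow> nat \<Rightarrow> (real \<Rightarrow> complex) \<Rightarrow> (real \<Rightarrow> complex) \<Rightarrow> int \<Rightarrow> complex" where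
  "fconv L NF g h k =
     (\<Sum>k' = - int NF..int NF.
        fourier_coeff L g k' *
        (if \<bar>k - k'\<bar> \<le> int NF then fourier_coeff L h (k - k') else 0))"

definition delta_v :: "real \<Rightarrow> real \<Rightarrow> (real \<Rightarrow> real \<Rightarrow> complex) \<Rightarrow> real \<Rightarrow> complex" where
  "delta_v va vb g x = (g x vb - g x va) / of_real (vb - va)"

(* Legendre index extended to the integers, with the conventions C_{-1} = C_{NL} = 0.
   Here c n k is the coefficient of phi_n(v) psi_k(x). *)
definition ext_coeff :: "nat \<Rightarrow> (nat \<Rightarrow> int \<Rightarrow> complex) \<Rightarrow> int \<Rightarrow> int \<Rightarrow> complex" where
  "ext_coeff NL c n k = (if 0 \<le> n \<and> n < int NL then c (nat n) k else 0)"

definition dist_fun ::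
  "real \<Rightarrow> real \<Rightarrow> real \<Rightarrow> nat \<Rightarrow> nat \<Rightarrow> (nat \<Rightarrow> int \<Rightarrow> complex) \<Rightarrow> real \<Rightarrow> real \<Rightarrow> complex" where
  "dist_fun L va vb NL NF c x v =
     (\<Sum>n<NL. trig_poly L NF (c n) x * of_real (phi va vb n v))"

definition mass ::
  "real \<Rightarrow> real \<Rightarrow> real \<Rightarrow> nat \<Rightarrow> nat \<Rightarrow> real \<Rightarrow> (nat \<Rightarrow> int \<Rightarrow> complex) \<Rightarrow> complex" where
  "mass L va vb NL NF m c =
     of_real m * integral {0..L} (\<lambda>x. integral {va..vb} (\<lambda>v. dist_fun L va vb NL NF c x v))"

(* The x-dependent function delta_v[(f0 + f1) phi_n], f0 and f1 having coefficients c0 and c1. *)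
definition bdry_jump ::
  "real \<Rightarrow> real \<Rightarrow> real \<Rightarrow> nat \<Rightarrow> nat \<Rightarrow> (nat \<Rightarrow> int \<Rightarrow> complex) \<Rightarrow> (nat \<Rightarrow> int \<Rightarrow> complex)
     \<Rightarrow> nat \<Rightarrow> real \<Rightarrow> complex" where
  "bdry_jump L va vb NL NF c0 c1 n =
     delta_v va vb
       (\<lambda>x v. (dist_fun L va vb NL NF c1 x v + dist_fun L va vb NL NF c0 x v)
               * of_real (phi va vb n v))"

(* B_{n,0}. *)
definition bdry_term ::
  "real \<Rightarrow> real \<Rightarrow> real \<Rightarrow> nat \<Rightarrow> nat \<Rightarrow> real \<Rightarrow> real
     \<Rightarrow> (nat \<Rightarrow> int \<Rightarrow> complex) \<Rightarrow> (nat \<Rightarrow> int \<Rightarrow> complex)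
     \<Rightarrow> (int \<Rightarrow> complex) \<Rightarrow> (int \<Rightarrow> complex) \<Rightarrow> nat \<Rightarrow> complex" where
  "bdry_term L va vb NL NF q \<gamma> c0 c1 e0 e1 n =
     - of_real \<gamma> * of_real (q / 4) * of_real (vb - va) * of_real L
       * fconv L NF (\<lambda>x. trig_poly L NF e1 x + trig_poly L NF e0 x)
           (bdry_jump L va vb NL NF c0 c1 n) 0"

(* One equation (indices n, k) of the Crank-Nicolson scheme for one species: c0, e0 are the
   plasma and field coefficients at the old time, c1, e1 those at the new time. *)
definition cn_equation ::
  "real \<Rightarrow> real \<Rightarrow> real \<Rightarrow> nat \<Rightarrow> nat \<Rightarrow> real \<Rightarrow> real \<Rightarrow> real \<Rightarrow> real \<Rightarrow> real
     \<Rightarrow> (nat \<Rightarrow> int \<Rightarrow> complex) \<Rightarrow> (nat \<Rightarrow> int \<Rightarrow> complex)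
     \<Rightarrow> (int \<Rightarrow> complex) \<Rightarrow> (int \<Rightarrow> complex) \<Rightarrow> nat \<Rightarrow> int \<Rightarrow> bool" where
  "cn_equation L va vb NL NF dt m q \<gamma> \<nu> c0 c1 e0 e1 n k \<longleftrightarrow>
     (let hatC = (\<lambda>j. ext_coeff NL c1 j k + ext_coeff NL c0 j k);
          hatE = (\<lambda>x. trig_poly L NF e1 x + trig_poly L NF e0 x)
      in (c1 n k - c0 n k) / of_real dt
         + of_real pi * \<i> / of_real L * of_int k
             * (of_real (sigma_coeff va vb (n + 1)) * hatC (int n + 1)
                + of_real (sigma_coeff va vb n) * hatC (int n - 1)
                + of_real (sigma_bar va vb) * hatC (int n))
         - of_real (q / (4 * m))
             * fconv L NF hatE
                 (\<lambda>x. (\<Sum>i<n. of_real (sigma2 va vb n i)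
                               * (trig_poly L NF (c1 i) x + trig_poly L NF (c0 i) x))
                       - of_real \<gamma> * bdry_jump L va vb NL NF c0 c1 n x) k
         = 1 / 2 * of_real (coll_coeff NL \<nu> n) * hatC (int n))"

end

theory Submission
  imports Defs
begin

text \<open>
  Only the two zero modes matter for the mass.  The Legendre polynomials of positive degree and
  the Fourier modes of nonzero frequency have mean zero, so the mass equals
  \<open>m L (v\<^sub>b - v\<^sub>a) C\<^sub>0\<^sub>,\<^sub>0\<close> (\<open>mass_eq\<close>).  In the equation of the scheme for \<open>n = k = 0\<close>, the
  transport term carries the factor \<open>k = 0\<close>, the sum over \<open>i < n\<close> is empty and the collision
  coefficient is zero.  Hence the increment of \<open>C\<^sub>0\<^sub>,\<^sub>0\<close> is the penalty term alone, and
  multiplication by \<open>m L (v\<^sub>b - v\<^sub>a)\<close> turns it into the boundary term.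

  The vanishing mean of \<open>L\<^sub>n\<close> for \<open>n \<ge> 1\<close> is obtained from the explicit antiderivative
  \<open>(x L\<^sub>n - L\<^sub>n\<^sub>-\<^sub>1) / (n + 1)\<close>, which is zero at both endpoints because
  \<open>L\<^sub>n(1) = 1\<close> and \<open>L\<^sub>n(-1) = (-1)\<^sup>n\<close>.  That it is an antiderivative amounts to the identity
  \<open>x L\<^sub>n' - L\<^sub>n\<^sub>-\<^sub>1' = n L\<^sub>n\<close>.
\<close>

text \<open>
  The derivative of \<open>legendre_poly\<close>, defined by the identity \<open>L\<^sub>n\<^sub>+\<^sub>1' = x L\<^sub>n' + (n + 1) L\<^sub>n\<close>
  rather than by differentiating the three-term recurrence: the companion identity
  \<open>legendre_deriv_companion\<close> is then pure algebra.
\<close>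

primrec legendre_deriv :: "nat \<Rightarrow> real \<Rightarrow> real" where
  "legendre_deriv 0 x = 0"
| "legendre_deriv (Suc n) x = x * legendre_deriv n x + (real n + 1) * legendre_poly n x"

lemma legendre_three_term:
  "(real n + 2) * legendre_poly (Suc (Suc n)) x
     = (2 * real n + 3) * x * legendre_poly (Suc n) x - (real n + 1) * legendre_poly n x"
  by simp

lemma legendre_deriv_companion:
  "x * legendre_deriv (Suc n) x - legendre_deriv n x = (real n + 1) * legendre_poly (Suc n) x"
proof (induction n)
  case 0
  then show ?case by simp
next
  case (Suc n)
  define D where "D = legendre_deriv n x"
  define D' where "D' = legendre_deriv (Suc n) x"
  define P where "P = legendre_poly n x"
  define Q where "Q = legendre_poly (Suc n) x"
  define R where "R = legendre_poly (Suc (Suc n)) x"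
  have 1: "x * D' - D = (real n + 1) * Q"
    using Suc.IH unfolding D_def D'_def Q_def .
  have 2: "D' = x * D + (real n + 1) * P"
    unfolding D_def D'_def P_def by simp
  have 3: "(real n + 2) * R = (2 * real n + 3) * x * Q - (real n + 1) * P"
    unfolding P_def Q_def R_def by (rule legendre_three_term)
  have 4: "legendre_deriv (Suc (Suc n)) x = x * D' + (real n + 2) * Q"
    unfolding D'_def Q_def by (simp only: legendre_deriv.simps(2) of_nat_Suc) (simp add: algebra_simps)
  have "x * (x * D' + (real n + 2) * Q) - D' = (real n + 2) * R"
    using 1 2 3 by algebra
  then show ?case
    using 4 unfolding D'_def R_def by (simp only: of_nat_Suc) (simp add: algebra_simps)
qed

lemma has_field_derivative_legendre_poly:
  "(legendre_poly n has_field_derivative legendre_deriv n x) (at x)"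
proof (induction n x rule: legendre_poly.induct)
  case (1 x)
  show ?case
    by (simp add: DERIV_const)
next
  case (2 x)
  show ?case
    by simp
next
  case (3 n x)
  have eq: "legendre_poly (Suc (Suc n)) = (\<lambda>x. ((2 * real n + 3) * x * legendre_poly (Suc n) x
      - (real n + 1) * legendre_poly n x) / (real n + 2))"
    by (rule ext) simp
  have "(legendre_poly (Suc (Suc n)) has_field_derivative
      ((2 * real n + 3) * (legendre_poly (Suc n) x + x * legendre_deriv (Suc n) x)
        - (real n + 1) * legendre_deriv n x) / (real n + 2)) (at x)"
    unfolding eq
    by (rule DERIV_cdivide)
      (rule derivative_eq_intros refl "3.IH"
        | simp add: algebra_simps del: legendre_deriv.simps legendre_poly.simps)+
  moreover have "((2 * real n + 3) * (legendre_poly (Suc n) x + x * legendre_deriv (Suc n) x)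
        - (real n + 1) * legendre_deriv n x) / (real n + 2) = legendre_deriv (Suc (Suc n)) x"
  proof -
    define D where "D = legendre_deriv n x"
    define D' where "D' = legendre_deriv (Suc n) x"
    define Q where "Q = legendre_poly (Suc n) x"
    have 1: "x * D' - D = (real n + 1) * Q"
      unfolding D_def D'_def Q_def by (rule legendre_deriv_companion)
    have 2: "legendre_deriv (Suc (Suc n)) x = x * D' + (real n + 2) * Q"
      unfolding D'_def Q_def by (simp only: legendre_deriv.simps(2) of_nat_Suc) (simp add: algebra_simps)
    have "(2 * real n + 3) * (Q + x * D') - (real n + 1) * D = (x * D' + (real n + 2) * Q) * (real n + 2)"
      using 1 by algebra
    then show ?thesis
      unfolding 2 unfolding D_def D'_def Q_def
      by (subst divide_eq_eq) auto
  qed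
  ultimately show ?case by metis
qed

lemma legendre_poly_1: "legendre_poly n 1 = 1"
  by (induction n "1::real" rule: legendre_poly.induct) (simp_all add: field_simps)

lemma legendre_poly_minus_1: "legendre_poly n (-1) = (-1) ^ n"
  by (induction n "-1::real" rule: legendre_poly.induct) (simp_all add: field_simps)

lemma has_integral_phi:
  assumes "va < vb"
  shows "(phi va vb n has_integral (if n = 0 then vb - va else 0)) {va..vb}"
proof (cases n)
  case 0
  have "phi va vb 0 = (\<lambda>_. 1)"
    by (auto simp: phi_def)
  then show ?thesis
    using has_integral_const_real[of "1::real" va vb] assms 0 by simp
next
  case (Suc j)
  define h where "h = (\<lambda>v. (2 * v - (va + vb)) / (vb - va))"
  \<comment> \<open>The antiderivative of \<open>L\<^sub>n\<close> that is zero at \<open>1\<close> and \<open>-1\<close>, with \<open>n = j + 1\<close>.\<close>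
  define A where "A = (\<lambda>x. (x * legendre_poly (Suc j) x - legendre_poly j x) / (real j + 2))"
  define F where "F = (\<lambda>v. sqrt (2 * real n + 1) * ((vb - va) / 2) * A (h v))"
  have A: "(A has_field_derivative legendre_poly (Suc j) x) (at x)" for x
  proof -
    have "(A has_field_derivative (legendre_poly (Suc j) x + x * legendre_deriv (Suc j) x
        - legendre_deriv j x) / (real j + 2)) (at x)"
      unfolding A_def
      by (rule DERIV_cdivide)
        (rule derivative_eq_intros refl has_field_derivative_legendre_poly
          | simp del: legendre_deriv.simps legendre_poly.simps)+
    moreover have "(legendre_poly (Suc j) x + x * legendre_deriv (Suc j) x
        - legendre_deriv j x) / (real j + 2) = legendre_poly (Suc j) x"
      using legendre_deriv_companion[of x j]
      by (simp add: divide_simps del: legendre_deriv.simps) (simp add: algebra_simps)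
    ultimately show ?thesis by metis
  qed
  have h: "(h has_field_derivative 2 / (vb - va)) (at v within S)" for v S
    unfolding h_def by (rule DERIV_cdivide) (rule derivative_eq_intros refl | simp)+
  have "(F has_vector_derivative phi va vb n v) (at v within {va..vb})" for v
  proof -
    have "((\<lambda>v. A (h v)) has_field_derivative legendre_poly (Suc j) (h v) * (2 / (vb - va)))
        (at v within {va..vb})"
      by (rule DERIV_chain2[OF A h])
    then have "(F has_field_derivative
        sqrt (2 * real n + 1) * ((vb - va) / 2) * (legendre_poly (Suc j) (h v) * (2 / (vb - va))))
        (at v within {va..vb})"
      unfolding F_def by (rule DERIV_cmult)
    moreover have "sqrt (2 * real n + 1) * ((vb - va) / 2)
        * (legendre_poly (Suc j) (h v) * (2 / (vb - va))) = phi va vb n v"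
      using assms Suc by (simp add: phi_def h_def)
    ultimately show ?thesis
      by (metis has_real_derivative_iff_has_vector_derivative)
  qed
  then have "(phi va vb n has_integral (F vb - F va)) {va..vb}"
    using assms by (intro fundamental_theorem_of_calculus) auto
  moreover have "h vb = 1" "h va = -1"
    using assms by (simp_all add: h_def field_simps)
  moreover have "A 1 = 0" "A (-1) = 0"
    unfolding A_def legendre_poly_1 legendre_poly_minus_1 by simp_all
  ultimately show ?thesis
    using Suc by (simp add: F_def)
qed

lemma has_integral_psi:
  assumes "L > 0"
  shows "(psi L k has_integral (if k = 0 then of_real L else 0)) {0..L}"
proof (cases "k = 0")
  case True
  have "psi L 0 = (\<lambda>_. 1)"
    by (auto simp: psi_def)
  then show ?thesis
    using has_integral_const_real[of "1::complex" 0 L] assms True by (simp add: scaleR_conv_of_real)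
next
  case False
  define w where "w = 2 * of_real pi * \<i> * of_int k / complex_of_real L"
  have w: "w \<noteq> 0"
    using False assms by (simp add: w_def)
  have psi: "psi L k = (\<lambda>x. exp (w * of_real x))"
    by (rule ext) (simp add: psi_def w_def)
  have "((\<lambda>x. exp (w * of_real x) / w) has_vector_derivative psi L k x) (at x within {0..L})" for x
  proof -
    have "((\<lambda>z. exp (w * z) / w) has_field_derivative exp (w * of_real x)) (at (of_real x))"
      using w by (auto intro!: derivative_eq_intros)
    then show ?thesis
      unfolding psi by (rule has_vector_derivative_real_field)
  qed
  then have "(psi L k has_integral (exp (w * of_real L) / w - exp (w * of_real 0) / w)) {0..L}"
    using assms by (intro fundamental_theorem_of_calculus) auto
  moreover have "exp (w * of_real L) = 1"
    using assms exp_integer_2pi[of "of_int k"] by (simp add: w_def mult_ac)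
  ultimately show ?thesis
    using False by simp
qed

lemma integral_trig_poly:
  assumes "L > 0"
  shows "integral {0..L} (trig_poly L NF a) = of_real L * a 0"
proof -
  have "(trig_poly L NF a has_integral
      (\<Sum>k = - int NF..int NF. a k * (if k = 0 then of_real L else 0))) {0..L}"
    unfolding trig_poly_def using has_integral_psi[OF assms]
    by (intro has_integral_sum has_integral_mult_right) auto
  also have "(\<Sum>k = - int NF..int NF. a k * (if k = 0 then of_real L else 0))
      = (\<Sum>k = - int NF..int NF. if k = 0 then of_real L * a 0 else 0)"
    by (intro sum.cong) auto
  also have "\<dots> = of_real L * a 0"
    by simp
  finally show ?thesis
    by (rule integral_unique)
qed

lemma integral_dist_fun:
  assumes "va < vb" and "NL > 0"
  shows "integral {va..vb} (dist_fun L va vb NL NF c x)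
    = of_real (vb - va) * trig_poly L NF (c 0) x"
proof -
  have phi: "((\<lambda>v. complex_of_real (phi va vb n v)) has_integral
      of_real (if n = 0 then vb - va else 0)) {va..vb}" for n
    using has_integral_phi[OF assms(1)] by (rule has_integral_of_real)
  have "(dist_fun L va vb NL NF c x has_integral
      (\<Sum>n<NL. trig_poly L NF (c n) x * of_real (if n = 0 then vb - va else 0))) {va..vb}"
    unfolding dist_fun_def by (intro has_integral_sum has_integral_mult_right phi) auto
  also have "(\<Sum>n<NL. trig_poly L NF (c n) x * of_real (if n = 0 then vb - va else 0))
      = (\<Sum>n<NL. if n = 0 then of_real (vb - va) * trig_poly L NF (c 0) x else 0)"
    by (intro sum.cong) auto
  also have "\<dots> = of_real (vb - va) * trig_poly L NF (c 0) x"
    using assms(2) by simp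
  finally show ?thesis
    by (rule integral_unique)
qed

lemma mass_eq:
  assumes "L > 0" and "va < vb" and "NL > 0"
  shows "mass L va vb NL NF m c = of_real m * of_real L * of_real (vb - va) * c 0 0"
  using integral_dist_fun[OF assms(2,3)] integral_trig_poly[OF assms(1)]
  by (simp add: mass_def)

lemma fourier_coeff_cmult: "fourier_coeff L (\<lambda>x. a * g x) j = a * fourier_coeff L g j"
  by (simp add: fourier_coeff_def mult.assoc)

lemma fconv_cmult_right: "fconv L NF g (\<lambda>x. a * h x) k = a * fconv L NF g h k"
  unfolding fconv_def fourier_coeff_cmult sum_distrib_left
  by (intro sum.cong) auto

text \<open>
  The instance \<open>n = k = 0\<close> of the scheme, in which only the time difference and the penalty
  term survive.
\<close>

lemma cn_equation_0_0:
  assumes "cn_equation L va vb NL NF dt m q \<gamma> \<nu> c0 c1 e0 e1 0 0" and "dt \<noteq> 0"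
  shows "c1 0 0 - c0 0 0 = - of_real dt * of_real (q / (4 * m)) * of_real \<gamma>
    * fconv L NF (\<lambda>x. trig_poly L NF e1 x + trig_poly L NF e0 x)
        (bdry_jump L va vb NL NF c0 c1 0) 0"
    (is "_ = - of_real dt * ?b * of_real \<gamma> * ?J")
proof -
  have "(c1 0 0 - c0 0 0) / of_real dt
      - ?b * fconv L NF (\<lambda>x. trig_poly L NF e1 x + trig_poly L NF e0 x)
          (\<lambda>x. (- of_real \<gamma>) * bdry_jump L va vb NL NF c0 c1 0 x) 0 = 0"
    using assms(1) by (simp add: cn_equation_def coll_coeff_def Let_def)
  then have "(c1 0 0 - c0 0 0) / of_real dt = - ?b * of_real \<gamma> * ?J"
    unfolding fconv_cmult_right by (simp add: eq_neg_iff_add_eq_0 algebra_simps)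
  then show ?thesis
    using assms(2) by (simp add: divide_eq_eq mult_ac)
qed

theorem mainTheorem7:
  fixes L va vb dt \<epsilon> t0 t1 :: real
    and NL NF :: nat
    and m q \<gamma> \<nu> :: "species \<Rightarrow> real"
    and C :: "species \<Rightarrow> real \<Rightarrow> nat \<Rightarrow> int \<Rightarrow> complex"
    and E :: "real \<Rightarrow> int \<Rightarrow> complex"
    and s :: species
  assumes "L > 0" and "va < vb" and "dt > 0" and "NL \<ge> 4"
    and "\<And>r. m r > 0" and "\<epsilon> > 0" and "\<And>r. \<nu> r \<ge> 0"
    and "t1 = t0 + dt"
    and C_real: "\<And>r t n x. t \<in> {t0, t1} \<Longrightarrow> n < NL \<Longrightarrow> trig_poly L NF (C r t n) x \<in> \<real>"
    and E_real: "\<And>t x. t \<in> {t0, t1} \<Longrightarrow> trig_poly L NF (E t) x \<in> \<real>"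
    and E_zero: "\<And>t. t \<in> {t0, t1} \<Longrightarrow> E t 0 = 0"
    and poisson: "\<And>t k. t \<in> {t0, t1} \<Longrightarrow> k \<in> {- int NF..int NF} \<Longrightarrow> k \<noteq> 0 \<Longrightarrow>
       of_real \<epsilon> * (2 * of_real pi * \<i> / of_real L * of_int k) * E t k
         = of_real (vb - va) * (\<Sum>r\<in>{Electron, Ion}. of_real (q r) * C r t 0 k)"
    and scheme: "\<And>r n k. n \<le> NL - 1 \<Longrightarrow> k \<in> {- int NF..int NF} \<Longrightarrow>
       cn_equation L va vb NL NF dt (m r) (q r) (\<gamma> r) (\<nu> r)
         (C r t0) (C r t1) (E t0) (E t1) n k"
  shows "mass L va vb NL NF (m s) (C s t1) - mass L va vb NL NF (m s) (C s t0)
    = of_real dt * bdry_term L va vb NL NF (q s) (\<gamma> s) (C s t0) (C s t1) (E t0) (E t1) 0"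
proof -
  have "cn_equation L va vb NL NF dt (m s) (q s) (\<gamma> s) (\<nu> s)
      (C s t0) (C s t1) (E t0) (E t1) 0 0"
    by (rule scheme) auto
  note increment = cn_equation_0_0[OF this]
  have "mass L va vb NL NF (m s) (C s t1) - mass L va vb NL NF (m s) (C s t0)
      = of_real (m s) * of_real L * of_real (vb - va) * (C s t1 0 0 - C s t0 0 0)"
    using assms(1,2,4) by (simp add: mass_eq algebra_simps)
  then show ?thesis
    using increment assms(3) assms(5)[of s] by (simp add: bdry_term_def)
qed

end
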